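(* There exists an online algorithm for $\textsc{Online-Sorting}[1,n]$ with competitive ratio at most $18\sqrt{n}$ (i.e., its cost is at most $18\sqrt n$ on every stream of $n$ reals in $[0,1]$). Moreover, every online algorithm for $\textsc{Online-Sorting}[1,n]$ has competitive ratio at least $\sqrt{n/2}$ (i.e., for every online algorithm there is an adaptively chosen stream of $n$ reals in $[0,1]$ on which its cost is at least $\sqrt{n/2}$).
   Context: $\textsc{Online-Sorting}[\gamma,n]$ (for $\gamma\ge 1$): there is an array $A$ consisting of $\gamma n$ initially empty cells, ordered from left to right. A stream of $n$ reals $s_1,\dots,s_n\in[0,1]$ arrives one at a time (the stream may be chosen adaptively by an adversary). An online algorithm must place each $s_i$ into an empty cell of $A$, irrevocably, before $s_{i+1}$ is revealed. After all reals are placed, let $r_1,\dots,r_n$ be the reals in left-to-right order in $A$, with $r_0:=0$, $r_{n+1}:=1$; the cost is $\sum_{i=0}^{n}|r_{i+1}-r_i|$. The offline optimum has cost exactly $1$, so an algorithm has competitive ratio $\Delta$ if its cost is at most $\Delta$ on every stream of $n$ reals. For $\gamma=1$ the array has exactly $n$ cells. *)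

theory Defs
  imports Complex_Main
begin

text \<open>A deterministic online algorithm for Online-Sorting[1,n]: when the i-th real
  arrives, it sees the whole prefix s_1..s_i of the stream (its own earlier choices are
  determined by that prefix) and returns the index (0-based) of the cell of the array of
  n cells into which s_i is placed.\<close>
type_synonym online_alg = "real list \<Rightarrow> nat"

definition valid_stream :: "nat \<Rightarrow> real list \<Rightarrow> bool" where
  "valid_stream n xs \<longleftrightarrow> length xs = n \<and> set xs \<subseteq> {0..1}"

definition place :: "online_alg \<Rightarrow> real list \<Rightarrow> nat \<Rightarrow> nat" where
  "place alg xs i = alg (take (Suc i) xs)"

definition valid_alg :: "nat \<Rightarrow> online_alg \<Rightarrow> bool" where
  "valid_alg n alg \<longleftrightarrow> (\<forall>xs. valid_stream n xs \<longrightarrow>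
      (\<forall>i<n. place alg xs i < n) \<and> inj_on (place alg xs) {..<n})"

definition cell :: "nat \<Rightarrow> online_alg \<Rightarrow> real list \<Rightarrow> nat \<Rightarrow> real" where
  "cell n alg xs j = xs ! (THE i. i < n \<and> place alg xs i = j)"

definition rseq :: "nat \<Rightarrow> online_alg \<Rightarrow> real list \<Rightarrow> nat \<Rightarrow> real" where
  "rseq n alg xs k = (if k = 0 then 0 else if k = Suc n then 1 else cell n alg xs (k - 1))"

definition sort_cost :: "nat \<Rightarrow> online_alg \<Rightarrow> real list \<Rightarrow> real" where
  "sort_cost n alg xs = (\<Sum>k\<le>n. \<bar>rseq n alg xs (Suc k) - rseq n alg xs k\<bar>)"

end

theory Submission
  imports Defs
begin

text \<open>Upper bound: divide the \<open>N\<close> free cells into blocks of about \<open>sqrt N / 2\<close> cells and the values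
  into nearly as many short intervals. Elements of one interval fill up a block of their own, and a
  new block is opened when that one is full. Once every block is in use, each interval has at most one
  unfinished block, so at most \<open>N / 4\<close> cells are free; these are treated recursively as one
  smaller array. Inserting a run into a sequence costs at most its own variation plus 2, so
  a phase costs at most \<open>17 / 2 * sqrt N\<close>, and the costs of the phases form a geometric series of ratio \<open>1 / 2\<close>.

  Lower bound: with \<open>k = floor (sqrt (2 * n))\<close>, the adversary sends multiples of \<open>1 / k\<close> so that no two
  equal values become neighbours, which costs \<open>1 / k\<close> for each of the \<open>n + 1\<close> pairs of neighbours. It can only get
  stuck when each of the \<open>k + 1\<close> values borders an empty cell; it then sends zeros.\<close>

section \<open>Total variation of a list\<close>

fun tv :: "real list \<Rightarrow> real" where
  "tv (x # y # ys) = \<bar>y - x\<bar> + tv (y # ys)"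
| "tv _ = 0"

lemma tv_conv_sum: "tv xs = (\<Sum>i<length xs - 1. \<bar>xs ! Suc i - xs ! i\<bar>)"
proof (induction xs rule: tv.induct)
  case (1 x y ys)
  then show ?case
    by (simp add: sum.lessThan_Suc_shift del: sum.lessThan_Suc)
qed auto

lemma tv_le_length:
  assumes "\<And>x y. x \<in> set xs \<Longrightarrow> y \<in> set xs \<Longrightarrow> \<bar>y - x\<bar> \<le> d"
  shows "tv xs \<le> real (length xs - 1) * d"
proof -
  have "tv xs \<le> (\<Sum>i<length xs - 1. d)"
    unfolding tv_conv_sum by (rule sum_mono) (auto intro!: assms)
  then show ?thesis by simp
qed

lemma tv_append: "tv (xs @ y # ys) = tv (xs @ [y]) + tv (y # ys)"
proof (induction xs)
  case (Cons a xs)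
  then show ?case by (cases xs) auto
qed simp

text \<open>Within \<open>[0,1]\<close> the step from \<open>l\<close> to the start of
  \<open>p\<close> costs at most 1, and by the triangle inequality replacing \<open>l\<close> by the
  last element of \<open>p\<close> in front of \<open>ys\<close> adds at most 1 more.\<close>

lemma tv_insert_run:
  assumes "set p \<subseteq> {0..1}" "l \<in> {0..1}"
  shows "tv (l # p @ ys) \<le> 2 + tv p + tv (l # ys)"
proof (cases p)
  case Nil
  then show ?thesis by simp
next
  case (Cons a q)
  obtain q' b where q': "p = q' @ [b]"
    using Cons by (metis list.distinct(1) rev_exhaust)
  have 1: "tv (l # p @ ys) = \<bar>a - l\<bar> + tv (p @ ys)"
    using Cons by simp
  have 2: "tv (p @ ys) = tv p + tv (b # ys)"
    using tv_append[of q' b ys] q' by simp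
  have "a \<in> set p" using Cons by simp
  moreover have "b \<in> set p" using q' by simp
  ultimately have ab: "a \<in> {0..1}" "b \<in> {0..1}"
    using assms by auto
  have 3: "tv (b # ys) \<le> \<bar>b - l\<bar> + tv (l # ys)"
    by (cases ys) auto
  show ?thesis
    using 1 2 3 ab assms(2) by auto
qed

section \<open>Game positions and strategies\<close>

text \<open>Positions of the game: \<^const>\<open>None\<close> marks an empty cell. The player can finish
  with cost at most \<open>c\<close> against every continuation of the stream.\<close>
inductive solvable :: "real \<Rightarrow> real option list \<Rightarrow> bool" for c where
  full: "tv (0 # ys @ [1]) \<le> c \<Longrightarrow> solvable c (map Some ys)"
| step: "None \<in> set L \<Longrightarrow>
    \<forall>x\<in>{0..1}. \<exists>j<length L. L ! j = None \<and> solvable c (L[j := Some x]) \<Longrightarrow> solvable c L"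

definition admissible :: "real option list \<Rightarrow> bool" where
  "admissible L \<longleftrightarrow> (\<forall>x. Some x \<in> set L \<longrightarrow> x \<in> {0..1})"

lemma admissible_update:
  "admissible L \<Longrightarrow> x \<in> {0..1} \<Longrightarrow> admissible (L[j := Some x])"
  unfolding admissible_def by (metis insertE option.inject set_update_subset_insert subsetD)

lemma admissible_map_Some: "admissible (map Some ys) \<longleftrightarrow> set ys \<subseteq> {0..1}"
  unfolding admissible_def by auto

abbreviation holes :: "'a option list \<Rightarrow> nat" where
  "holes L \<equiv> count_list L None"

lemma holes_update:
  assumes "j < length L" "L ! j = None"
  shows "Suc (holes (L[j := Some x])) = holes L"
proof -
  have "L = take j L @ None # drop (Suc j) L"
    using assms by (metis id_take_nth_drop)
  then have "holes L = holes (take j L) + Suc (holes (drop (Suc j) L))"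
    by (metis (no_types, lifting) count_list.simps(2) count_list_append Suc_eq_plus1)
  moreover have "L[j := Some x] = take j L @ Some x # drop (Suc j) L"
    using assms by (simp add: upd_conv_take_nth_drop)
  ultimately show ?thesis by simp
qed

lemma no_None_iff: "None \<notin> set L \<longleftrightarrow> (\<exists>ys. L = map Some ys)"
proof
  assume "None \<notin> set L"
  then have "L = map Some (map the L)"
    by (induction L) auto
  then show "\<exists>ys. L = map Some ys" by blast
qed auto

lemma solvable_mono: "solvable c L \<Longrightarrow> c \<le> d \<Longrightarrow> solvable d L"
proof (induction rule: solvable.induct)
  case (full ys)
  then show ?case by (auto intro: solvable.full)
next
  case (step L)
  then show ?case by (intro solvable.step) blast+
qed

text \<open>Any choice of empty cells will do: the final array with its two end values has
  \<open>length L + 1\<close> gaps, each of size at most 1. This settles small arrays.\<close>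

lemma solvable_trivial:
  "admissible L \<Longrightarrow> solvable (real (length L) + 1) L"
proof (induction "holes L" arbitrary: L rule: less_induct)
  case less
  show ?case
  proof (cases "None \<in> set L")
    case True
    then obtain j where j: "j < length L" "L ! j = None"
      by (meson in_set_conv_nth)
    have "solvable (real (length L) + 1) (L[j := Some x])" if "x \<in> {0..1}" for x
      using less.hyps[of "L[j := Some x]"] holes_update[OF j, of x]
        admissible_update[OF less.prems that, of j] by simp
    then show ?thesis using True j by (intro solvable.step) blast+
  next
    case False
    then obtain ys where ys: "L = map Some ys" using no_None_iff by blast
    then have "set ys \<subseteq> {0..1}" using less.prems admissible_map_Some by blast
    then have "set (0 # ys @ [1]) \<subseteq> {0..1}" by auto
    moreover have "\<bar>y - x\<bar> \<le> 1" if "x \<in> {0..1}" "y \<in> {0..1}" for x y :: real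
      using that by auto
    ultimately have "tv (0 # ys @ [1]) \<le> real (length (0 # ys @ [1]) - 1) * 1"
      by (intro tv_le_length) (meson subsetD)
    then show ?thesis unfolding ys by (intro solvable.full) simp
  qed
qed

section \<open>Playing a smaller game in the empty cells\<close>

text \<open>The empty cells of \<open>L\<close>, read from left to right, form an array of their own
  with position \<open>M\<close>. Entries of \<open>M\<close> may again be \<open>None\<close>, so a
  recursive game can be carried on inside \<open>L\<close>.\<close>

fun fill_in :: "'a option list \<Rightarrow> 'a option list \<Rightarrow> 'a option list" where
  "fill_in (None # L) (b # M) = b # fill_in L M"
| "fill_in (Some a # L) M = Some a # fill_in L M"
| "fill_in L M = L"

lemma fill_in_Nil [simp]: "fill_in L [] = L"
proof (induction L)
  case (Cons a L)
  then show ?case by (cases a) auto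
qed simp

lemma fill_in_None: "fill_in L (replicate (holes L) None) = L"
proof (induction L)
  case (Cons a L)
  then show ?case by (cases a) auto
qed simp

lemma fill_in_update:
  assumes "j < length M" "M ! j = None" "length M = holes L"
  shows "\<exists>i<length (fill_in L M). fill_in L M ! i = None \<and>
    (fill_in L M)[i := Some x] = fill_in L (M[j := Some x])"
  using assms
proof (induction L M arbitrary: j rule: fill_in.induct)
  case (1 L b M)
  show ?case
  proof (cases j)
    case 0
    then show ?thesis using 1 by auto
  next
    case (Suc j')
    then obtain i where "i < length (fill_in L M)" "fill_in L M ! i = None"
      "(fill_in L M)[i := Some x] = fill_in L (M[j' := Some x])"
      using 1 by auto
    then show ?thesis using Suc by (intro exI[of _ "Suc i"]) auto
  qed
next
  case (2 a L M)
  then obtain i where "i < length (fill_in L M)" "fill_in L M ! i = None"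
      "(fill_in L M)[i := Some x] = fill_in L (M[j := Some x])"
    by auto
  then show ?case by (intro exI[of _ "Suc i"]) auto
qed auto

lemma None_in_fill_in:
  "None \<in> set M \<Longrightarrow> length M = holes L \<Longrightarrow> None \<in> set (fill_in L M)"
  by (metis fill_in_update in_set_conv_nth nth_mem)

text \<open>The strategy for \<open>M\<close> is copied move by move through
  \<open>fill_in_update\<close>. Only finished arrays are charged, and \<open>e\<close> bounds the
  extra variation caused by the values already in \<open>L\<close>.\<close>

lemma solvable_fill_in:
  assumes e: "\<And>ys. length ys = holes L \<Longrightarrow> set ys \<subseteq> {0..1} \<Longrightarrow>
      \<exists>zs. fill_in L (map Some ys) = map Some zs \<and> tv (0 # zs @ [1]) \<le> tv (0 # ys @ [1]) + e"
  shows "solvable c M \<Longrightarrow> length M = holes L \<Longrightarrow> admissible M \<Longrightarrow> solvable (c + e) (fill_in L M)"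
proof (induction rule: solvable.induct)
  case (full ys)
  then obtain zs where "fill_in L (map Some ys) = map Some zs"
    "tv (0 # zs @ [1]) \<le> tv (0 # ys @ [1]) + e"
    using e[of ys] admissible_map_Some by auto
  then show ?case using full by (auto intro: solvable.full)
next
  case (step M)
  have "\<exists>i<length (fill_in L M). fill_in L M ! i = None \<and>
      solvable (c + e) ((fill_in L M)[i := Some x])" if x: "x \<in> {0..1}" for x
  proof -
    obtain j where j: "j < length M" "M ! j = None" "solvable (c + e) (fill_in L (M[j := Some x]))"
      using step x by (metis admissible_update length_list_update)
    then show ?thesis using fill_in_update[OF j(1,2), of L x] step.prems by metis
  qed
  then show ?case using step None_in_fill_in by (intro solvable.step) auto
qed

section \<open>Blocks, and one phase of filling them\<close>

abbreviation block :: "nat \<Rightarrow> real list \<Rightarrow> real option list" where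
  "block s p \<equiv> map Some p @ replicate (s - length p) None"

text \<open>The \<open>r\<close> trailing cells are the remainder of the division into blocks of
  \<open>s\<close> cells; they are left to the recursive game.\<close>

definition layout :: "nat \<Rightarrow> nat \<Rightarrow> real list list \<Rightarrow> real option list" where
  "layout s r bs = concat (map (block s) bs) @ replicate r None"

lemma layout_simps:
  "layout s r [] = replicate r None"
  "layout s r (p # bs) = map Some p @ replicate (s - length p) None @ layout s r bs"
  by (auto simp: layout_def)

lemma holes_replicate [simp]: "holes (replicate k None) = k"
  by (induction k) auto

lemma holes_map_Some [simp]: "holes (map Some p) = 0"
  by (induction p) auto

lemma holes_layout: "holes (layout s r bs) = (\<Sum>p\<leftarrow>bs. s - length p) + r"
  by (induction bs) (auto simp: layout_simps)

lemma fill_in_block: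
  "k \<le> length M \<Longrightarrow> fill_in (map Some p @ replicate k None @ L) M =
    map Some p @ take k M @ fill_in L (drop k M)"
proof (induction p)
  case Nil
  then show ?case
  proof (induction k arbitrary: M)
    case (Suc k)
    then show ?case by (cases M) auto
  qed simp
qed auto

text \<open>Seen from the finished small array \<open>ys\<close>, each block inserts its run
  \<open>p\<close> at one place, at cost \<open>2 + tv p\<close> by \<open>tv_insert_run\<close>. In
  the induction \<open>l\<close> is the last value of the small array to the left of the current
  block, initially the end value.\<close>

lemma fill_in_layout:
  assumes "\<forall>p\<in>set bs. set p \<subseteq> {0..1}" "length ys = holes (layout s r bs)"
    "set ys \<subseteq> {0..1}" "l \<in> {0..1}"
  shows "\<exists>zs. fill_in (layout s r bs) (map Some ys) = map Some zs \<and>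
    tv (l # zs @ [1]) \<le> tv (l # ys @ [1]) + (\<Sum>p\<leftarrow>bs. 2 + tv p)"
  using assms
proof (induction bs arbitrary: ys l)
  case Nil
  have "fill_in (replicate r None) (map Some ys) = map Some ys"
    using Nil fill_in_block[of r "map Some ys" "[]" "[]"] by (simp add: layout_simps)
  then show ?case by (auto simp: layout_simps)
next
  case (Cons p bs)
  let ?k = "s - length p"
  define us where "us = take ?k ys"
  define vs where "vs = drop ?k ys"
  have len: "length ys = ?k + holes (layout s r bs)"
    using Cons.prems(2) by (simp add: layout_simps)
  have ys: "ys = us @ vs" by (simp add: us_def vs_def)
  \<comment> \<open>The fallback to \<open>l\<close> covers a full block, which receives nothing
    from \<open>ys\<close>.\<close>
  define l' where "l' = last (l # us)"
  have l': "l' \<in> {0..1}"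
    using Cons.prems(3,4) last_in_set[of "l # us"] unfolding l'_def ys by (auto simp del: last.simps)
  obtain us' where us': "l # us = us' @ [l']"
    unfolding l'_def by (metis append_butlast_last_id list.distinct(1))
  obtain zs where zs: "fill_in (layout s r bs) (map Some vs) = map Some zs"
    "tv (l' # zs @ [1]) \<le> tv (l' # vs @ [1]) + (\<Sum>p\<leftarrow>bs. 2 + tv p)"
  proof -
    have "set vs \<subseteq> {0..1}" using Cons.prems(3) ys by simp
    moreover have "length vs = holes (layout s r bs)" using len by (simp add: vs_def)
    moreover have "\<forall>p\<in>set bs. set p \<subseteq> {0..1}" using Cons.prems(1) by simp
    ultimately show ?thesis using Cons.IH[of vs l'] l' that by blast
  qed
  have "fill_in (layout s r (p # bs)) (map Some ys) = map Some (p @ us @ zs)"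
    using fill_in_block[of ?k "map Some ys" p "layout s r bs"] len zs(1)
    by (simp add: layout_simps us_def vs_def take_map drop_map)
  moreover have "tv (l # (p @ us @ zs) @ [1]) \<le> tv (l # ys @ [1]) + (\<Sum>p\<leftarrow>p # bs. 2 + tv p)"
  proof -
    have "tv (l # p @ us @ zs @ [1]) \<le> 2 + tv p + tv (l # us @ zs @ [1])"
      using Cons.prems by (intro tv_insert_run) auto
    moreover have "tv (l # us @ ws) = tv (us' @ [l']) + tv (l' # ws)" for ws
      using tv_append[of us' l' ws] us' by (metis append.assoc append_Cons append_Nil)
    ultimately show ?thesis using zs(2) by (simp add: ys)
  qed
  ultimately show ?case by blast
qed

lemma layout_place:
  assumes "i < length bs" "length (bs ! i) < s"
  shows "\<exists>j<length (layout s r bs). layout s r bs ! j = None \<and>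
    (layout s r bs)[j := Some x] = layout s r (bs[i := bs ! i @ [x]])"
proof -
  define as where "as = take i bs"
  define cs where "cs = drop (Suc i) bs"
  define p where "p = bs ! i"
  have bs: "bs = as @ p # cs" and bs': "bs[i := p @ [x]] = as @ (p @ [x]) # cs"
    using assms by (simp_all add: as_def cs_def p_def id_take_nth_drop upd_conv_take_nth_drop)
  define U where "U = concat (map (block s) as) @ map Some p"
  define V where "V = replicate (s - Suc (length p)) None @ concat (map (block s) cs) @ replicate r None"
  have "replicate (s - length p) (None :: real option) = None # replicate (s - Suc (length p)) None"
    using assms by (metis Suc_diff_Suc p_def replicate_Suc)
  then have "layout s r bs = U @ None # V" "layout s r (bs[i := p @ [x]]) = U @ Some x # V"
    unfolding bs' unfolding bs by (simp_all add: layout_def U_def V_def)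
  then show ?thesis
    unfolding p_def[symmetric] by (intro exI[of _ "length U"]) auto
qed

text \<open>One phase: every block holds values of a single class, and every class has at most one
  block that is neither empty nor full. The phase stops as soon as all blocks are in use.\<close>
lemma solvable_phase:
  fixes cls :: "real \<Rightarrow> nat" and \<delta> :: real
  assumes "s > 0"
    and cls: "\<And>x. x \<in> {0..1} \<Longrightarrow> cls x < K"
    and near: "\<And>x y. x \<in> {0..1} \<Longrightarrow> y \<in> {0..1} \<Longrightarrow> cls x = cls y \<Longrightarrow> \<bar>y - x\<bar> \<le> \<delta>"
    and "\<delta> \<ge> 0"
    and rest: "\<And>R. R \<le> K * (s - 1) + r \<Longrightarrow> solvable C (replicate R None)"
  shows "\<lbrakk>length bs = B; \<forall>p\<in>set bs. length p \<le> s \<and> set p \<subseteq> {0..1} \<and> (\<forall>x\<in>set p. cls x = cls (hd p));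
     \<forall>i<B. \<forall>j<B. bs ! i \<noteq> [] \<and> bs ! j \<noteq> [] \<and> length (bs ! i) < s \<and> length (bs ! j) < s
        \<and> cls (hd (bs ! i)) = cls (hd (bs ! j)) \<longrightarrow> i = j\<rbrakk>
    \<Longrightarrow> solvable (C + (2 * real B + real (B * s) * \<delta>)) (layout s r bs)"
proof (induction "holes (layout s r bs)" arbitrary: bs rule: less_induct)
  case less
  note len = less.prems(1) and blk = less.prems(2) and open1 = less.prems(3)
  show ?case
  proof (cases "[] \<in> set bs")
    case True
    then obtain i0 where i0: "i0 < B" "bs ! i0 = []"
      by (metis in_set_conv_nth len)
    have "\<exists>j<length (layout s r bs). layout s r bs ! j = None \<and>
        solvable (C + (2 * real B + real (B * s) * \<delta>)) ((layout s r bs)[j := Some x])"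
      if x: "x \<in> {0..1}" for x
    proof -
      \<comment> \<open>The move: continue the unfinished block of the class of \<open>x\<close> if
        there is one, otherwise open the empty block \<open>i0\<close>.\<close>
      obtain i where i: "i < B" "length (bs ! i) < s"
        and icls: "bs ! i \<noteq> [] \<Longrightarrow> cls (hd (bs ! i)) = cls x"
        and inew: "bs ! i = [] \<Longrightarrow> \<forall>j<B. bs ! j \<noteq> [] \<and> length (bs ! j) < s \<longrightarrow> cls (hd (bs ! j)) \<noteq> cls x"
      proof (cases "\<exists>i<B. bs ! i \<noteq> [] \<and> length (bs ! i) < s \<and> cls (hd (bs ! i)) = cls x")
        case True
        then show ?thesis using that by blast
      next
        case False
        then show ?thesis using that[of i0] i0 \<open>s > 0\<close> by auto
      qed
      define bs' where "bs' = bs[i := bs ! i @ [x]]"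
      have ib: "i < length bs" using i len by simp
      have mem: "bs ! i \<in> set bs" using ib by simp
      obtain j where j: "j < length (layout s r bs)" "layout s r bs ! j = None"
        "(layout s r bs)[j := Some x] = layout s r bs'"
        using layout_place[OF ib i(2)] unfolding bs'_def by blast
      have hd': "cls (hd (bs ! i @ [x])) = cls x"
        using icls by (cases "bs ! i") auto
      have "solvable (C + (2 * real B + real (B * s) * \<delta>)) (layout s r bs')"
      proof (rule less.hyps)
        show "holes (layout s r bs') < holes (layout s r bs)"
          using holes_update[OF j(1,2), of x] j(3) by simp
        show "length bs' = B" using len by (simp add: bs'_def)
        have "length q \<le> s \<and> set q \<subseteq> {0..1} \<and> (\<forall>y\<in>set q. cls y = cls (hd q))"
          if "q = bs ! i @ [x]" for q
        proof -
          have "cls y = cls x" if "y \<in> set (bs ! i)" for y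
            using blk mem icls that by (metis empty_iff list.set(1))
          then show ?thesis
            using that blk mem x i(2) hd' by auto
        qed
        then show "\<forall>p\<in>set bs'. length p \<le> s \<and> set p \<subseteq> {0..1} \<and> (\<forall>x\<in>set p. cls x = cls (hd p))"
          unfolding bs'_def using blk set_update_subset_insert by fastforce
        have nth: "bs' ! k = (if k = i then bs ! i @ [x] else bs ! k)" if "k < B" for k
          using that len by (simp add: bs'_def nth_list_update)
        \<comment> \<open>Either \<open>i\<close> already was the unfinished block of this class, or
          it was empty because there was none. So extending \<open>i\<close> leaves at most one such
          block per class.\<close>
        have other: "k = i" if "k < B" "bs ! k \<noteq> []" "length (bs ! k) < s" "cls (hd (bs ! k)) = cls x" for k
          using that i icls inew open1 by metis
        show "\<forall>k<B. \<forall>l<B. bs' ! k \<noteq> [] \<and> bs' ! l \<noteq> [] \<and> length (bs' ! k) < s \<and> length (bs' ! l) < s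
           \<and> cls (hd (bs' ! k)) = cls (hd (bs' ! l)) \<longrightarrow> k = l"
        proof (intro allI impI; elim conjE)
          fix k l
          assume kl: "k < B" "l < B" "bs' ! k \<noteq> []" "bs' ! l \<noteq> []"
            "length (bs' ! k) < s" "length (bs' ! l) < s" "cls (hd (bs' ! k)) = cls (hd (bs' ! l))"
          show "k = l"
          proof (cases "k = i"; cases "l = i")
            assume "k = i" "l \<noteq> i"
            then show ?thesis using kl other[of l] hd' nth[OF kl(1)] nth[OF kl(2)] by simp
          next
            assume "k \<noteq> i" "l = i"
            then show ?thesis using kl other[of k] hd' nth[OF kl(1)] nth[OF kl(2)] by simp
          next
            assume "k \<noteq> i" "l \<noteq> i"
            then show ?thesis using kl open1 nth[OF kl(1)] nth[OF kl(2)] by metis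
          qed simp
        qed
      qed
      then show ?thesis using j by auto
    qed
    moreover have "None \<in> set (layout s r bs)"
      using layout_place[of i0 bs s r] i0 len \<open>s > 0\<close> by (auto simp: in_set_conv_nth)
    ultimately show ?thesis by (intro solvable.step) auto
  next
    case False
    \<comment> \<open>All blocks are in use now. The unfinished ones have distinct classes, so there
      are at most \<open>K\<close> of them, and being nonempty each has at most \<open>s - 1\<close>
      free cells.\<close>
    define P where "P = {i. i < B \<and> length (bs ! i) < s}"
    have ne: "bs ! i \<noteq> []" if "i < B" for i
      using False that len by (metis nth_mem)
    have "inj_on (\<lambda>i. cls (hd (bs ! i))) P"
      using open1 ne by (auto simp: P_def inj_on_def)
    moreover have "(\<lambda>i. cls (hd (bs ! i))) ` P \<subseteq> {..<K}"
    proof safe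
      fix i assume "i \<in> P"
      then have "hd (bs ! i) \<in> set (bs ! i)" "bs ! i \<in> set bs"
        using ne len by (auto simp: P_def)
      then show "cls (hd (bs ! i)) < K" using blk cls by blast
    qed
    ultimately have cardP: "card P \<le> K"
      by (metis card_inj_on_le card_lessThan finite_lessThan)
    have "(\<Sum>p\<leftarrow>bs. s - length p) = (\<Sum>i<B. s - length (bs ! i))"
      using len by (simp add: sum_list_sum_nth atLeast0LessThan)
    also have "\<dots> = (\<Sum>i\<in>P. s - length (bs ! i))"
      by (intro sum.mono_neutral_right) (auto simp: P_def)
    also have "\<dots> \<le> (\<Sum>i\<in>P. s - 1)"
    proof (rule sum_mono)
      fix i assume "i \<in> P"
      then have "length (bs ! i) > 0" using ne by (auto simp: P_def)
      then show "s - length (bs ! i) \<le> s - 1" by linarith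
    qed
    also have "\<dots> \<le> K * (s - 1)" using cardP by simp
    finally have "solvable C (replicate (holes (layout s r bs)) None)"
      by (intro rest) (simp add: holes_layout)
    moreover have "\<exists>zs. fill_in (layout s r bs) (map Some ys) = map Some zs \<and>
        tv (0 # zs @ [1]) \<le> tv (0 # ys @ [1]) + (\<Sum>p\<leftarrow>bs. 2 + tv p)"
      if "length ys = holes (layout s r bs)" "set ys \<subseteq> {0..1}" for ys
      using fill_in_layout[of bs ys s r 0] blk that by auto
    ultimately have "solvable (C + (\<Sum>p\<leftarrow>bs. 2 + tv p))
        (fill_in (layout s r bs) (replicate (holes (layout s r bs)) None))"
      by (intro solvable_fill_in) (auto simp: admissible_def)
    then have sol: "solvable (C + (\<Sum>p\<leftarrow>bs. 2 + tv p)) (layout s r bs)"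
      by (simp add: fill_in_None)
    have "2 + tv p \<le> 2 + real s * \<delta>" if "p \<in> set bs" for p
    proof -
      have p: "set p \<subseteq> {0..1}" "\<And>x. x \<in> set p \<Longrightarrow> cls x = cls (hd p)" "length p \<le> s"
        using blk that by auto
      have "\<bar>y - x\<bar> \<le> \<delta>" if "x \<in> set p" "y \<in> set p" for x y
        using near[of x y] p that by (metis subsetD)
      then have "tv p \<le> real (length p - 1) * \<delta>"
        by (rule tv_le_length)
      also have "\<dots> \<le> real s * \<delta>"
        using p(3) \<open>\<delta> \<ge> 0\<close> by (intro mult_right_mono) auto
      finally show ?thesis by simp
    qed
    then have "(\<Sum>p\<leftarrow>bs. 2 + tv p) \<le> (\<Sum>p\<leftarrow>bs. 2 + real s * \<delta>)"
      by (rule sum_list_mono)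
    also have "\<dots> = 2 * real B + real (B * s) * \<delta>"
      using len by (simp add: sum_list_triv algebra_simps)
    finally show ?thesis using sol by (auto intro: solvable_mono)
  qed
qed

section \<open>The recursion over phases\<close>

text \<open>With \<open>t = sqrt N\<close>, a phase costs at most \<open>17 / 2 * t\<close> and
  leaves at most \<open>N / 4\<close> free cells, which cost \<open>1 + 17 * (t / 2)\<close> by
  induction. The summand 1 is the cost of an array without cells.\<close>

lemma solvable_empty: "solvable (1 + 17 * sqrt (real N)) (replicate N None)"
proof (induction N rule: less_induct)
  case (less N)
  show ?case
  \<comment> \<open>289 is the square of 17: below it the trivial bound \<open>N + 1\<close>
    suffices, and from there on \<open>t \<ge> 17\<close> pays for all roundings.\<close>
  proof (cases "N < 289")
    case True
    have "real N = sqrt (real N) * sqrt (real N)" by simp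
    also have "\<dots> \<le> 17 * sqrt (real N)"
      using True by (intro mult_right_mono real_le_lsqrt) auto
    finally show ?thesis
      using solvable_trivial[of "replicate N None"] by (auto simp: admissible_def intro: solvable_mono)
  next
    case False
    define t where "t = sqrt (real N)"
    have t: "t \<ge> 17" "t * t = real N"
      using False real_le_rsqrt[of 17 "real N"] by (auto simp: t_def)
    define q where "q = nat \<lfloor>t / 2\<rfloor>"
    have q: "real q \<le> t / 2" "t / 2 < real q + 1"
      using t by (auto simp: q_def) linarith+
    have q8: "q \<ge> 8" using q t by linarith
    \<comment> \<open>The value 1 has a class of its own, which makes \<open>m + 1 = q - 1\<close>
      classes. With blocks of \<open>q + 1\<close> cells a phase leaves at most
      \<open>(q - 1) * q\<close> free cells in the blocks and at most \<open>q\<close> outside,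
      together \<open>q * q \<le> N / 4\<close>.\<close>
    define m where "m = q - 2"
    define s where "s = q + 1"
    define B where "B = N div s"
    have m: "real m = real q - 2" "m > 0" using q8 by (auto simp: m_def)
    define cls where "cls = (\<lambda>x. nat \<lfloor>real m * x\<rfloor>)"
    have cls: "cls x < Suc m" if "x \<in> {0..1}" for x
    proof -
      have "real m * x \<le> real m" using that by (simp add: mult_left_le)
      then show ?thesis unfolding cls_def by linarith
    qed
    have near: "\<bar>y - x\<bar> \<le> 1 / real m" if "x \<in> {0..1}" "y \<in> {0..1}" "cls x = cls y" for x y
    proof -
      have "\<lfloor>real m * x\<rfloor> = \<lfloor>real m * y\<rfloor>"
        using that by (simp add: cls_def eq_nat_nat_iff)
      then have "\<bar>real m * y - real m * x\<bar> \<le> 1" by linarith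
      moreover have "real m * \<bar>y - x\<bar> = \<bar>real m * y - real m * x\<bar>"
        by (metis abs_mult abs_of_nat right_diff_distrib)
      ultimately have "real m * \<bar>y - x\<bar> \<le> 1" by simp
      then show ?thesis using \<open>m > 0\<close> by (simp add: pos_le_divide_eq mult.commute)
    qed
    have rest: "solvable (1 + 17 * (t / 2)) (replicate R None)"
      if R: "R \<le> Suc m * (s - 1) + N mod s" for R
    proof -
      have "N mod s \<le> q" using mod_less_divisor[of s N] by (simp add: s_def del: mod_less_divisor)
      moreover have "R \<le> Suc m * q + N mod s" using R by (simp add: s_def)
      ultimately have "R \<le> (m + 2) * q" by simp
      moreover have "m + 2 = q" using q8 by (simp add: m_def)
      ultimately have "real R \<le> real q * real q"
        by (metis of_nat_le_iff of_nat_mult)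
      also have "\<dots> \<le> (t / 2) * (t / 2)"
        using q by (intro mult_mono) auto
      finally have R': "real R \<le> (t / 2) * (t / 2)" .
      then have "real R < real N" using t by (simp add: field_simps) (use False in linarith)
      moreover have "sqrt (real R) \<le> t / 2"
        using R' t by (intro real_le_lsqrt) (auto simp: power2_eq_square)
      ultimately show ?thesis using less[of R] by (auto intro: solvable_mono)
    qed
    let ?c = "1 + 17 * (t / 2) + (2 * real B + real (B * s) * (1 / real m))"
    have "solvable ?c (layout s (N mod s) (replicate B []))"
      by (rule solvable_phase[where cls = cls and K = "Suc m"])
         (use cls near rest in \<open>auto simp: s_def\<close>)
    moreover have "layout s (N mod s) (replicate B []) = replicate N None"
    proof -
      have "concat (map (block s) (replicate k [])) = replicate (k * s) None" for k
        by (induction k) (auto simp: replicate_add)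
      then show ?thesis by (simp add: layout_def B_def flip: replicate_add)
    qed
    ultimately have "solvable ?c (replicate N None)" by simp
    \<comment> \<open>Blocks are longer than \<open>t / 2\<close>, so there are at most
      \<open>2 * t\<close> of them and their insertion costs \<open>4 * t\<close>. This leaves
      \<open>9 / 2 * t\<close> for the variation inside the blocks.\<close>
    moreover have "2 * real B + real (B * s) * (1 / real m) \<le> 17 * (t / 2)"
    proof -
      have "B * s \<le> N" by (simp add: B_def)
      then have "real (B * s) \<le> t * t" unfolding t(2) by (simp only: of_nat_le_iff)
      moreover have "t * t \<le> (2 * t) * real s"
        using q t mult_left_mono[of t "2 * real s" t] by (simp add: s_def algebra_simps)
      ultimately have "real B * real s \<le> (2 * t) * real s" by simp
      then have "real B \<le> 2 * t" by (simp add: s_def)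
      moreover have "real (B * s) * (1 / real m) \<le> 9 / 2 * t"
      proof -
        \<comment> \<open>The fraction is the reciprocal of the remaining \<open>9 / 2\<close>; it
          is admissible since \<open>m > t / 2 - 3\<close> and \<open>t \<ge> 17\<close>.\<close>
        have "2 / 9 * t \<le> real m" using q t m by linarith
        then have "t * t \<le> (9 / 2 * t) * real m"
          using t mult_left_mono[of "2 / 9 * t" "real m" "9 / 2 * t"] by simp
        with \<open>real (B * s) \<le> t * t\<close> have "real (B * s) \<le> (9 / 2 * t) * real m"
          by linarith
        then have "real (B * s) / real m \<le> 9 / 2 * t"
          using \<open>m > 0\<close> by (subst pos_divide_le_eq) auto
        then show ?thesis by simp
      qed
      ultimately show ?thesis by linarith
    qed
    then have "?c \<le> 1 + 17 * t" by linarith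
    ultimately show ?thesis unfolding t_def[symmetric] by (rule solvable_mono)
  qed
qed

section \<open>From strategies to online algorithms\<close>

text \<open>An injection of a finite set into itself is onto, so each cell receives exactly one
  element and the description in \<open>cell\<close> picks it.\<close>

lemma rseq_eq_nth:
  assumes "length ys = n" "length xs = n" "inj_on (place alg xs) {..<n}"
    and "\<And>i. i < n \<Longrightarrow> place alg xs i < n \<and> ys ! place alg xs i = xs ! i"
    and "k \<le> Suc n"
  shows "rseq n alg xs k = (0 # ys @ [1]) ! k"
proof -
  have surj: "place alg xs ` {..<n} = {..<n}"
    using assms(3,4) by (intro endo_inj_surj) auto
  have "cell n alg xs j = ys ! j" if "j < n" for j
  proof -
    have "j \<in> place alg xs ` {..<n}" using \<open>j < n\<close> surj by simp
    then obtain i where i: "i < n" "place alg xs i = j" by auto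
    have "(THE i. i < n \<and> place alg xs i = j) = i"
      using i assms(3) by (intro the_equality) (auto simp: inj_on_def)
    then show ?thesis using i assms(4)[of i] by (simp add: cell_def)
  qed
  then show ?thesis
    using assms(1,5) by (auto simp: rseq_def nth_Cons' nth_append)
qed

text \<open>An \<open>online_alg\<close> stores no array, but the prefix of the stream determines
  it: replaying a fixed strategy on all but the last element rebuilds the position in which the last
  one is to be placed.\<close>

lemma alg_of_solvable:
  assumes "solvable c (replicate n None)"
  shows "\<exists>alg. valid_alg n alg \<and> (\<forall>xs. valid_stream n xs \<longrightarrow> sort_cost n alg xs \<le> c)"
proof -
  \<comment> \<open>A fixed good move for each solvable position with an empty cell. Elsewhere the
    value is arbitrary; by \<open>inv\<close> it is never consulted there on a valid stream.\<close>
  define \<sigma> where "\<sigma> = (\<lambda>L x. SOME j. j < length L \<and> L ! j = None \<and> solvable c (L[j := Some x]))"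
  have \<sigma>: "\<sigma> L x < length L \<and> L ! \<sigma> L x = None \<and> solvable c (L[\<sigma> L x := Some x])"
    if "solvable c L" "None \<in> set L" "x \<in> {0..1}" for L x
  proof -
    have "\<exists>j. j < length L \<and> L ! j = None \<and> solvable c (L[j := Some x])"
      using that(1) by cases (use that in auto)
    then show ?thesis unfolding \<sigma>_def by (rule someI_ex)
  qed
  define st where "st = foldl (\<lambda>L x. L[\<sigma> L x := Some x]) (replicate n None)"
  define alg where "alg = (\<lambda>xs. \<sigma> (st (butlast xs)) (last xs))"
  have run: "inj_on (place alg xs) {..<n} \<and> (\<forall>i<n. place alg xs i < n) \<and> sort_cost n alg xs \<le> c"
    if xs: "valid_stream n xs" for xs
  proof -
    have len: "length xs = n" and in01: "\<And>i. i < n \<Longrightarrow> xs ! i \<in> {0..1}"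
      using xs unfolding valid_stream_def by (metis nth_mem subsetD)+
    have place: "place alg xs i = \<sigma> (st (take i xs)) (xs ! i)" if "i < n" for i
      using that len by (simp add: place_def alg_def take_Suc_conv_app_nth)
    have st_Suc: "st (take (Suc i) xs) = (st (take i xs))[place alg xs i := Some (xs ! i)]" if "i < n" for i
      using that len place[OF that] by (simp add: st_def take_Suc_conv_app_nth)
    \<comment> \<open>The count of empty cells guarantees a free one for the next element. Since the
      chosen cell is empty while all earlier ones are filled, placements stay distinct.\<close>
    have inv: "solvable c (st (take i xs)) \<and> length (st (take i xs)) = n \<and> holes (st (take i xs)) = n - i \<and>
        inj_on (place alg xs) {..<i} \<and>
        (\<forall>k<i. place alg xs k < n \<and> st (take i xs) ! place alg xs k = Some (xs ! k))" if "i \<le> n" for i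
      using that
    proof (induction i)
      case 0
      then show ?case using assms by (simp add: st_def)
    next
      case (Suc i)
      let ?L = "st (take i xs)" and ?j = "place alg xs i"
      have "None \<in> set ?L"
        using Suc by (metis Suc_leD Suc_le_lessD count_notin zero_less_diff less_numeral_extra(3))
      then have j: "?j < n" "?L ! ?j = None" "solvable c (?L[?j := Some (xs ! i)])"
        using \<sigma>[of ?L "xs ! i"] Suc place[of i] in01[of i] by auto
      moreover have "holes (?L[?j := Some (xs ! i)]) = n - Suc i"
        using holes_update[of ?j ?L "xs ! i"] j Suc by auto
      moreover have ne: "place alg xs k \<noteq> ?j" if "k < i" for k
        using that j Suc by (metis Suc_leD option.distinct(1))
      moreover have "inj_on (place alg xs) {..<Suc i}"
        using ne Suc by (fastforce simp: lessThan_Suc inj_on_insert)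
      moreover have "?L[?j := Some (xs ! i)] ! place alg xs k = Some (xs ! k)" if "k < i" for k
        using ne[OF that] Suc that by simp
      ultimately show ?case
        using Suc st_Suc[of i] by (auto simp: less_Suc_eq)
    qed
    define L where "L = st xs"
    have fin: "solvable c L" "length L = n" "holes L = 0" "inj_on (place alg xs) {..<n}"
      "\<And>k. k < n \<Longrightarrow> place alg xs k < n \<and> L ! place alg xs k = Some (xs ! k)"
      using inv[of n] len by (auto simp: L_def)
    have "None \<notin> set L" using fin(3) by (metis count_list_0_iff)
    with fin(1) obtain ys where ys: "L = map Some ys" "tv (0 # ys @ [1]) \<le> c"
      by cases auto
    have "rseq n alg xs k = (0 # ys @ [1]) ! k" if "k \<le> Suc n" for k
    proof (rule rseq_eq_nth)
      show "place alg xs i < n \<and> ys ! place alg xs i = xs ! i" if "i < n" for i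
        using fin(2) fin(5)[OF that] ys by auto
    qed (use fin ys len that in auto)
    then have "sort_cost n alg xs = tv (0 # ys @ [1])"
      using fin(2) ys by (auto simp: sort_cost_def tv_conv_sum lessThan_Suc_atMost intro!: sum.cong)
    then show ?thesis using fin ys by auto
  qed
  then show ?thesis by (intro exI[of _ alg]) (auto simp: valid_alg_def)
qed

section \<open>Partially filled arrays\<close>

text \<open>The counterpart of \<open>rseq\<close> for a prefix of the stream, with the same
  numbering: cell \<open>j\<close> sits at \<open>j + 1\<close>, and the end values count as
  neighbours.\<close>

definition board :: "nat \<Rightarrow> online_alg \<Rightarrow> real list \<Rightarrow> nat \<Rightarrow> real option" where
  "board n alg xs k =
    (if k = 0 then Some 0 else if k = Suc n then Some 1
     else if \<exists>i<length xs. place alg xs i = k - 1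
       then Some (xs ! (THE i. i < length xs \<and> place alg xs i = k - 1)) else None)"

lemma board_full:
  assumes "valid_alg n alg" "valid_stream n xs" "k \<le> Suc n"
  shows "board n alg xs k = Some (rseq n alg xs k)"
proof -
  have len: "length xs = n" using assms by (simp add: valid_stream_def)
  have "place alg xs ` {..<n} = {..<n}"
    using assms by (intro endo_inj_surj) (auto simp: valid_alg_def)
  then have "\<exists>i<n. place alg xs i = j" if "j < n" for j
    using that by (metis imageE lessThan_iff)
  then show ?thesis using assms(3) len by (auto simp: board_def rseq_def cell_def)
qed

lemma place_append: "i < length xs \<Longrightarrow> place alg (xs @ ys) i = place alg xs i"
  by (simp add: place_def)

text \<open>Validity speaks of streams of length \<open>n\<close> only. Padding with zeros gives
  such a stream without changing the earlier placements.\<close>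

lemma place_prefix:
  assumes "valid_alg n alg" "set xs \<subseteq> {0..1}" "length xs \<le> n"
  shows "inj_on (place alg xs) {..<length xs}" "i < length xs \<Longrightarrow> place alg xs i < n"
proof -
  let ?ys = "xs @ replicate (n - length xs) 0"
  have "valid_stream n ?ys" using assms by (auto simp: valid_stream_def)
  then have *: "inj_on (place alg ?ys) {..<n}" "\<And>i. i < n \<Longrightarrow> place alg ?ys i < n"
    using assms(1) by (auto simp: valid_alg_def)
  show "inj_on (place alg xs) {..<length xs}"
  proof (rule inj_onI)
    fix i j assume "i \<in> {..<length xs}" "j \<in> {..<length xs}" "place alg xs i = place alg xs j"
    then show "i = j"
      using inj_onD[OF *(1), of i j] assms(3) by (simp add: place_append)
  qed
  show "i < length xs \<Longrightarrow> place alg xs i < n"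
    using *(2)[of i] assms(3) by (simp add: place_append)
qed

lemma board_eq_Some_iff:
  assumes "valid_alg n alg" "set xs \<subseteq> {0..1}" "length xs \<le> n" "0 < k" "k \<le> n"
  shows "board n alg xs k = Some v \<longleftrightarrow> (\<exists>i<length xs. place alg xs i = k - 1 \<and> xs ! i = v)"
proof -
  have "(THE i. i < length xs \<and> place alg xs i = k - 1) = i"
    if "i < length xs" "place alg xs i = k - 1" for i
    using that place_prefix(1)[OF assms(1-3)] by (intro the_equality) (auto simp: inj_on_def)
  then show ?thesis using assms(4,5) by (auto simp: board_def)
qed

lemma board_append:
  assumes "valid_alg n alg" "set (xs @ ys) \<subseteq> {0..1}" "length (xs @ ys) \<le> n" "k \<le> Suc n"
  shows "board n alg xs k = Some v \<Longrightarrow> board n alg (xs @ ys) k = Some v"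
    and "board n alg xs k = None \<Longrightarrow> board n alg (xs @ ys) k = Some v \<Longrightarrow> v \<in> set ys"
proof -
  consider "k = 0 \<or> k = Suc n" | "0 < k" "k \<le> n" using assms(4) by linarith
  note cases = this
  show "board n alg (xs @ ys) k = Some v" if "board n alg xs k = Some v"
    using cases
  proof cases
    case 1
    then show ?thesis using that by (auto simp: board_def)
  next
    case 2
    then obtain i where "i < length xs" "place alg xs i = k - 1" "xs ! i = v"
      using \<open>board n alg xs k = Some v\<close> board_eq_Some_iff[of n alg xs k v] assms by auto
    then show ?thesis
      using 2 board_eq_Some_iff[of n alg "xs @ ys" k v] assms
      by (auto simp: place_append nth_append intro!: exI[of _ i])
  qed
  show "v \<in> set ys" if "board n alg xs k = None" "board n alg (xs @ ys) k = Some v"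
    using cases
  proof cases
    case 1
    then show ?thesis using that by (auto simp: board_def)
  next
    case 2
    then obtain i where i: "i < length (xs @ ys)" "place alg (xs @ ys) i = k - 1" "(xs @ ys) ! i = v"
      using \<open>board n alg (xs @ ys) k = Some v\<close> board_eq_Some_iff[of n alg "xs @ ys" k v] assms by auto
    have "\<not> i < length xs"
      using i 2 \<open>board n alg xs k = None\<close> board_eq_Some_iff[of n alg xs k "xs ! i"] assms
      by (auto simp: place_append)
    then show ?thesis using i by (auto simp: nth_append)
  qed
qed

text \<open>One arrival fills one cell. Hence two neighbours are never both filled by the same
  arrival.\<close>

lemma board_snoc_new_unique:
  assumes "valid_alg n alg" "set (xs @ [v]) \<subseteq> {0..1}" "length (xs @ [v]) \<le> n" "k \<le> Suc n"
    and "board n alg xs k = None" "board n alg (xs @ [v]) k \<noteq> None"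
  shows "k = Suc (place alg (xs @ [v]) (length xs))"
proof -
  have k: "0 < k" "k \<le> n" using assms(4,5) by (auto simp: board_def split: if_splits)
  obtain i where i: "i < length (xs @ [v])" "place alg (xs @ [v]) i = k - 1"
    using assms k by (auto simp: board_def split: if_splits)
  have "\<not> i < length xs"
    using i k assms(5) by (auto simp: board_def place_append split: if_splits)
  then show ?thesis using i k by (cases "i = length xs") auto
qed

section \<open>The adversary\<close>

text \<open>The adversary's stream is a longest one over \<open>{0, 1/k, \<dots>, 1}\<close> without equal neighbours,
  completed by zeros.\<close>
lemma lower_bound_stream:
  assumes alg: "valid_alg n alg" and "k \<ge> 1" "n \<ge> 1"
  shows "\<exists>xs. valid_stream n xs \<and>
    (sort_cost n alg xs \<ge> real (n + 1) / real k \<or> sort_cost n alg xs \<ge> real (k + 1) / 2)"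
proof -
  define val where "val = (\<lambda>i. real i / real k)"
  define S where "S = val ` {..k}"
  have S01: "S \<subseteq> {0..1}" using \<open>k \<ge> 1\<close> by (auto simp: S_def val_def)
  have S0: "0 \<in> S" and S1: "1 \<in> S" using \<open>k \<ge> 1\<close> by (auto simp: S_def val_def image_iff intro: bexI[of _ k] bexI[of _ 0])
  have inj: "inj_on val {..k}" using \<open>k \<ge> 1\<close> by (auto simp: inj_on_def val_def)
  have gap: "\<bar>a - b\<bar> \<ge> 1 / real k" if ab: "a \<in> S" "b \<in> S" "a \<noteq> b" for a b
  proof -
    obtain i j where ij: "a = val i" "b = val j" "i \<noteq> j" using ab by (auto simp: S_def)
    have "1 \<le> \<bar>real i - real j\<bar>" using ij by linarith
    then show ?thesis using ij \<open>k \<ge> 1\<close> by (simp add: val_def flip: diff_divide_distrib) (simp add: abs_divide divide_right_mono)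
  qed
  \<comment> \<open>Prefixes without two equal filled neighbours, the ends included. Their length is
    at most \<open>n\<close>, so a longest one exists.\<close>
  define Q where "Q = (\<lambda>xs. set xs \<subseteq> S \<and> length xs \<le> n \<and>
    (\<forall>j\<le>n. \<forall>a. \<not> (board n alg xs j = Some a \<and> board n alg xs (Suc j) = Some a)))"
  have "Q []" using \<open>n \<ge> 1\<close> by (auto simp: Q_def board_def)
  moreover have "\<forall>xs. Q xs \<longrightarrow> length xs \<le> n" by (simp add: Q_def)
  ultimately have "\<exists>xs. Q xs \<and> (\<forall>ys. Q ys \<longrightarrow> length ys \<le> length xs)"
    by (intro ex_has_greatest_nat[where b = "Suc n"]) (auto simp: less_Suc_eq_le)
  then obtain xs where xs: "Q xs" and max: "\<And>ys. Q ys \<Longrightarrow> length ys \<le> length xs"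
    by blast
  define zs where "zs = xs @ replicate (n - length xs) 0"
  have xsS: "set xs \<subseteq> S" and lxs: "length xs \<le> n" using xs by (auto simp: Q_def)
  have zsv: "valid_stream n zs"
    using xsS lxs S01 by (auto simp: valid_stream_def zs_def)
  have full: "board n alg zs j = Some (rseq n alg zs j)" if "j \<le> Suc n" for j
    using board_full[OF alg zsv that] .
  show ?thesis
  proof (cases "length xs = n")
    case True
    then have zs: "zs = xs" by (simp add: zs_def)
    have inS: "rseq n alg zs j \<in> S" if "j \<le> Suc n" for j
    proof (cases "0 < j \<and> j \<le> n")
      case True
      then obtain i where "i < length zs" "zs ! i = rseq n alg zs j"
        using board_eq_Some_iff[OF alg _ _ _ _, of zs j] full[OF \<open>j \<le> Suc n\<close>] zsv True
        by (auto simp: valid_stream_def)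
      then show ?thesis using xsS zs by (metis nth_mem subsetD)
    next
      case False
      then show ?thesis using that S0 S1 by (auto simp: rseq_def)
    qed
    \<comment> \<open>The adversary was never stuck: every gap joins two distinct elements of
      \<open>S\<close>, as the end values 0 and 1 lie in \<open>S\<close> too.\<close>
    have "1 / real k \<le> \<bar>rseq n alg zs (Suc j) - rseq n alg zs j\<bar>" if "j \<le> n" for j
      using xs that full[of j] full[of "Suc j"] inS[of j] inS[of "Suc j"]
      by (intro gap) (auto simp: Q_def zs)
    then have "(\<Sum>j\<le>n. 1 / real k) \<le> sort_cost n alg zs"
      unfolding sort_cost_def by (intro sum_mono) auto
    then show ?thesis using zsv by (auto simp: add.commute)
  next
    case False
    then have lt: "length xs < n" using lxs by simp
    \<comment> \<open>The adversary is stuck: by maximality sending \<open>v\<close> creates an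
      equal pair. Exactly one of its two cells is newly filled, and with \<open>v\<close>; so the
      other held \<open>v\<close> before and bordered an empty cell.\<close>
    have "\<exists>j\<le>n. (board n alg xs j = Some v \<and> board n alg xs (Suc j) = None) \<or>
        (board n alg xs j = None \<and> board n alg xs (Suc j) = Some v)" if v: "v \<in> S" for v
    proof -
      have 01: "set (xs @ [v]) \<subseteq> {0..1}" and len: "length (xs @ [v]) \<le> n"
        using v xsS S01 lt by auto
      have "\<not> Q (xs @ [v])" using max[of "xs @ [v]"] by auto
      then obtain j a where j: "j \<le> n" "board n alg (xs @ [v]) j = Some a"
        "board n alg (xs @ [v]) (Suc j) = Some a"
        using v xsS len by (auto simp: Q_def)
      note keep = board_append(1)[OF alg 01 len] and new = board_append(2)[OF alg 01 len]
      have notboth: "\<not> (board n alg xs j = None \<and> board n alg xs (Suc j) = None)"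
        using board_snoc_new_unique[OF alg 01 len, of j] board_snoc_new_unique[OF alg 01 len, of "Suc j"] j
        by force
      have notold: "\<not> (board n alg xs j \<noteq> None \<and> board n alg xs (Suc j) \<noteq> None)"
      proof
        assume "board n alg xs j \<noteq> None \<and> board n alg xs (Suc j) \<noteq> None"
        then have "board n alg xs j = Some a" "board n alg xs (Suc j) = Some a"
          using keep[of j] keep[of "Suc j"] j by auto
        then show False using xs j by (auto simp: Q_def)
      qed
      then consider b where "board n alg xs j = Some b" "board n alg xs (Suc j) = None"
        | b where "board n alg xs j = None" "board n alg xs (Suc j) = Some b"
        using notboth by fastforce
      then show ?thesis
      proof cases
        case 1
        then have "b = a" "a = v" using j keep[of j b] new[of "Suc j" a] by auto
        then show ?thesis using 1 j by blast
      next
        case 2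
        then have "b = a" "a = v" using j keep[of "Suc j" b] new[of j a] by auto
        then show ?thesis using 2 j by blast
      qed
    qed
    \<comment> \<open>\<open>e v\<close> names such a gap. Only one of its ends is filled, and with
      \<open>v\<close>, so the gap determines \<open>v\<close>; this makes \<open>e\<close>
      injective.\<close>
    then obtain e where e: "\<And>v. v \<in> S \<Longrightarrow> e v \<le> n \<and>
        ((board n alg xs (e v) = Some v \<and> board n alg xs (Suc (e v)) = None) \<or>
        (board n alg xs (e v) = None \<and> board n alg xs (Suc (e v)) = Some v))"
      by metis
    have "inj_on e S"
    proof (rule inj_onI)
      fix v w assume "v \<in> S" "w \<in> S" "e v = e w"
      have "v = w" if "(x = Some v \<and> y = None) \<or> (x = None \<and> y = Some v)"
        "(x = Some w \<and> y = None) \<or> (x = None \<and> y = Some w)" for x y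
        using that by auto
      then show "v = w" using e[OF \<open>v \<in> S\<close>] e[OF \<open>w \<in> S\<close>] \<open>e v = e w\<close> by metis
    qed
    have zs01: "set (xs @ replicate (n - length xs) 0) \<subseteq> {0..1}" "length (xs @ replicate (n - length xs) 0) \<le> n"
      using zsv by (auto simp: valid_stream_def zs_def)
    have old: "rseq n alg zs j = v" if "board n alg xs j = Some v" "j \<le> Suc n" for j v
      using board_append(1)[OF alg zs01 that(2,1)] full[OF that(2)] by (simp add: zs_def)
    have zero: "rseq n alg zs j = 0" if "board n alg xs j = None" "j \<le> Suc n" for j
      using board_append(2)[OF alg zs01 that(2,1)] full[OF that(2)] by (auto simp: zs_def)
    \<comment> \<open>The padding puts 0 into every empty cell, so the gap \<open>e v\<close> ends
      up between \<open>v\<close> and 0.\<close>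
    have "v \<le> \<bar>rseq n alg zs (Suc (e v)) - rseq n alg zs (e v)\<bar>" if "v \<in> S" for v
      using e[OF that] old[of "e v" v] old[of "Suc (e v)" v] zero[of "e v"] zero[of "Suc (e v)"] by auto
    then have "(\<Sum>v\<in>S. v) \<le> (\<Sum>v\<in>S. \<bar>rseq n alg zs (Suc (e v)) - rseq n alg zs (e v)\<bar>)"
      by (rule sum_mono)
    also have "\<dots> = (\<Sum>j\<in>e ` S. \<bar>rseq n alg zs (Suc j) - rseq n alg zs j\<bar>)"
      using \<open>inj_on e S\<close> by (simp add: sum.reindex)
    also have "\<dots> \<le> sort_cost n alg zs"
      unfolding sort_cost_def using e by (intro sum_mono2) auto
    also have "(\<Sum>v\<in>S. v) = (\<Sum>i\<le>k. val i)"
      using inj by (simp add: S_def sum.reindex)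
    also have "\<dots> = real (k + 1) / 2"
    proof -
      have "(\<Sum>i\<le>k. real i) = real k * (real k + 1) / 2"
        by (induction k) (auto simp: field_simps)
      then show ?thesis using \<open>k \<ge> 1\<close> by (simp add: val_def add.commute flip: sum_divide_distrib)
    qed
    finally show ?thesis using zsv by auto
  qed
qed

section \<open>The two bounds with explicit constants\<close>

theorem theorem3:
  fixes n :: nat
  assumes "n \<ge> 1"
  shows "(\<exists>alg. valid_alg n alg \<and>
            (\<forall>xs. valid_stream n xs \<longrightarrow> sort_cost n alg xs \<le> 18 * sqrt (real n)))
       \<and> (\<forall>alg. valid_alg n alg \<longrightarrow>
            (\<exists>xs. valid_stream n xs \<and> sort_cost n alg xs \<ge> sqrt (real n / 2)))"
proof
  \<comment> \<open>This absorbs the additive 1 in \<open>1 + 17 * sqrt n\<close>.\<close>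
  have "sqrt (real n) \<ge> 1" using assms by simp
  then have "solvable (18 * sqrt (real n)) (replicate n None)"
    using solvable_empty[of n] by (auto intro: solvable_mono)
  then show "\<exists>alg. valid_alg n alg \<and> (\<forall>xs. valid_stream n xs \<longrightarrow> sort_cost n alg xs \<le> 18 * sqrt (real n))"
    by (rule alg_of_solvable)
next
  define t where "t = sqrt (real n / 2)"
  have t: "t > 0" "t * t = real n / 2" using assms by (auto simp: t_def)
  have "1 / 2 \<le> t" unfolding t_def using assms by (intro real_le_rsqrt) (auto simp: power2_eq_square)
  \<comment> \<open>Here \<open>2 * t\<close> is \<open>sqrt (2 * n)\<close>, which balances the two
    outcomes: \<open>k \<le> 2 * t\<close> gives \<open>(n + 1) / k \<ge> t\<close> because
    \<open>2 * t * t = n\<close>, and \<open>k + 1 > 2 * t\<close> gives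
    \<open>(k + 1) / 2 \<ge> t\<close>.\<close>
  define k where "k = nat \<lfloor>2 * t\<rfloor>"
  have k: "k \<ge> 1" "real k \<le> 2 * t" "2 * t < real k + 1"
    using \<open>1 / 2 \<le> t\<close> by (auto simp: k_def le_nat_floor)
  have "t * real k \<le> t * (2 * t)" using k t by (intro mult_left_mono) auto
  moreover have "t * (2 * t) = real n" using t(2) by simp
  ultimately have "t * real k \<le> real (n + 1)" by linarith
  then have "t \<le> real (n + 1) / real k" using k by (simp add: field_simps)
  moreover have "t \<le> real (k + 1) / 2" using k by simp
  ultimately have "c \<ge> t" if "c \<ge> real (n + 1) / real k \<or> c \<ge> real (k + 1) / 2" for c
    using that by linarith
  then show "\<forall>alg. valid_alg n alg \<longrightarrow> (\<exists>xs. valid_stream n xs \<and> sort_cost n alg xs \<ge> sqrt (real n / 2))"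
    unfolding t_def[symmetric] using lower_bound_stream[OF _ k(1) assms] by blast
qed

end
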